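(* Let $\mathcal{A}$ be an independence algebra with universe $A$ and let $\mathcal{B}$ be a non-empty subalgebra of $\mathcal{A}$ with universe $B$. Assume $\mathcal{B}\neq\mathcal{A}$ and that either $\dim B\geq 2$, or $\langle\emptyset\rangle\neq\emptyset$ and $\dim B=1$. Let $T(\mathcal{A},\mathcal{B})$ be the semigroup of all endomorphisms of $\mathcal{A}$ whose image is contained in $B$. Then the ideals of $T(\mathcal{A},\mathcal{B})$ are precisely the sets $T_{r(S)}\cup K(S)$ and $T_{r(S)^+}\cup K(S)$, where $S$ is a non-empty subset of $T(\mathcal{A},\mathcal{B})$.
   Context: An algebra $\mathcal{A}=\langle A;F\rangle$ has a non-empty universe $A$ and a set $F$ of finitary operations. For $X\subseteq A$, $\langle X\rangle$ is the set of all $t(a_1,\dots,a_n)$ with $t$ a term operation and $a_i\in X$ (the subalgebra generated by $X$); $\langle\emptyset\rangle$ is the set of constants, i.e. values of nullary term operations (possibly empty). $X$ is independent if $x\notin\langle X\setminus\{x\}\rangle$ for all $x\in X$; a basis of a subalgebra is an independent generating set. Exchange property (EP): for all $X\subseteq A$ and $a,b\in A$, if $b\in\langle X\cup\{a\}\rangle$ and $b\notin\langle X\rangle$ then $a\in\langle X\cup\{b\}\rangle$. Under (EP) every subalgebra has a basis, all its bases have the same cardinality (its dimension, $\dim$), and independent sets extend to bases. Free basis property (F): every map from a basis of $\mathcal{A}$ to $A$ extends to an endomorphism of $\mathcal{A}$. An independence algebra is an algebra satisfying (EP) and (F). Dimensions may be finite or infinite. Maps are written on the right and composed left to right. $\rho(\alpha)=\dim(A\alpha)$;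 $\ker\alpha=\{(x,y)\in A\times A: x\alpha=y\alpha\}$; $\kappa^+$ is the successor cardinal of a cardinal $\kappa$ (so $n^+=n+1$ for finite $n$). "Ideal" means non-empty two-sided ideal. For a cardinal $k$, $T_k=\{\alpha\in T(\mathcal{A},\mathcal{B}):\rho(\alpha)<k\}$. For a non-empty $S\subseteq T(\mathcal{A},\mathcal{B})$: $$r(S)=\min\{\kappa\leq(\dim B)^+ : \dim(B\alpha)<\kappa\ \text{for all }\alpha\in S\},$$ $$K(S)=\{\beta\in T(\mathcal{A},\mathcal{B}) : \ker\alpha\subseteq\ker\beta\text{ for some }\alpha\in S\}.$$ *)

theory Defs
  imports Main "HOL-Library.FuncSet"
begin

unbundle cardinal_syntax

text \<open>
  An operation is a pair \<open>(n, f)\<close> of an arity and a function on lists; only the values of \<open>f\<close>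
  on lists of length \<open>n\<close> over the universe are meaningful. Nullary operations are the pairs
  with \<open>n = 0\<close>, whose value is \<open>f []\<close>.
\<close>

type_synonym 'a operation = "nat \<times> ('a list \<Rightarrow> 'a)"

definition closed_under :: "'a operation set \<Rightarrow> 'a set \<Rightarrow> bool" where
  "closed_under F U \<longleftrightarrow> (\<forall>(n, f) \<in> F. \<forall>xs. length xs = n \<and> set xs \<subseteq> U \<longrightarrow> f xs \<in> U)"

definition is_algebra :: "'a set \<Rightarrow> 'a operation set \<Rightarrow> bool" where
  "is_algebra A F \<longleftrightarrow> A \<noteq> {} \<and> closed_under F A"

definition subalgebra :: "'a set \<Rightarrow> 'a operation set \<Rightarrow> 'a set \<Rightarrow> bool" where
  "subalgebra A F U \<longleftrightarrow> U \<subseteq> A \<and> closed_under F U"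

text \<open>
  The \<open>n\<close>-ary term operations. For \<open>n = 0\<close> there are no projections, so these
  are built from the nullary basic operations.
\<close>

inductive_set term_ops :: "'a operation set \<Rightarrow> nat \<Rightarrow> ('a list \<Rightarrow> 'a) set"
  for F :: "'a operation set" and n :: nat where
  proj: "i < n \<Longrightarrow> (\<lambda>xs. xs ! i) \<in> term_ops F n"
| comp: "(m, f) \<in> F \<Longrightarrow> length ts = m \<Longrightarrow> \<forall>t \<in> set ts. t \<in> term_ops F n
          \<Longrightarrow> (\<lambda>xs. f (map (\<lambda>t. t xs) ts)) \<in> term_ops F n"

definition gen :: "'a operation set \<Rightarrow> 'a set \<Rightarrow> 'a set" where
  "gen F X = {t xs | t n xs. t \<in> term_ops F n \<and> length xs = n \<and> set xs \<subseteq> X}"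

definition independent :: "'a operation set \<Rightarrow> 'a set \<Rightarrow> bool" where
  "independent F X \<longleftrightarrow> (\<forall>x \<in> X. x \<notin> gen F (X - {x}))"

definition is_basis :: "'a operation set \<Rightarrow> 'a set \<Rightarrow> 'a set \<Rightarrow> bool" where
  "is_basis F U X \<longleftrightarrow> independent F X \<and> gen F X = U"

definition exchange_property :: "'a set \<Rightarrow> 'a operation set \<Rightarrow> bool" where
  "exchange_property A F \<longleftrightarrow>
     (\<forall>X a b. X \<subseteq> A \<and> a \<in> A \<and> b \<in> A \<and> b \<in> gen F (X \<union> {a}) \<and> b \<notin> gen F X
        \<longrightarrow> a \<in> gen F (X \<union> {b}))"

text \<open>Maps on \<open>A\<close> are extensional functions, so that equal maps are equal as HOL functions.\<close>

definition endomorphisms :: "'a set \<Rightarrow> 'a operation set \<Rightarrow> ('a \<Rightarrow> 'a) set" where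
  "endomorphisms A F =
     {\<alpha> \<in> A \<rightarrow>\<^sub>E A. \<forall>(n, f) \<in> F. \<forall>xs. length xs = n \<and> set xs \<subseteq> A \<longrightarrow> \<alpha> (f xs) = f (map \<alpha> xs)}"

definition free_basis_property :: "'a set \<Rightarrow> 'a operation set \<Rightarrow> bool" where
  "free_basis_property A F \<longleftrightarrow>
     (\<forall>X g. is_basis F A X \<and> g \<in> X \<rightarrow> A \<longrightarrow> (\<exists>\<alpha> \<in> endomorphisms A F. \<forall>x \<in> X. \<alpha> x = g x))"

definition independence_algebra :: "'a set \<Rightarrow> 'a operation set \<Rightarrow> bool" where
  "independence_algebra A F \<longleftrightarrow>
     is_algebra A F \<and> exchange_property A F \<and> free_basis_property A F"

text \<open>
  In an independence algebra, all bases of a subalgebra exist and are equipotent, so the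
  choice of the basis matters only up to isomorphism of cardinals.
\<close>

definition dim :: "'a operation set \<Rightarrow> 'a set \<Rightarrow> 'a rel" where
  "dim F U = |SOME X. is_basis F U X|"

definition T_semigroup :: "'a set \<Rightarrow> 'a operation set \<Rightarrow> 'a set \<Rightarrow> ('a \<Rightarrow> 'a) set" where
  "T_semigroup A F B = {\<alpha> \<in> endomorphisms A F. \<alpha> ` A \<subseteq> B}"

text \<open>Composition from left to right: \<open>\<alpha>\<close> is applied first.\<close>

definition mult :: "'a set \<Rightarrow> ('a \<Rightarrow> 'a) \<Rightarrow> ('a \<Rightarrow> 'a) \<Rightarrow> ('a \<Rightarrow> 'a)" where
  "mult A \<alpha> \<beta> = compose A \<beta> \<alpha>"

definition is_ideal :: "('s \<Rightarrow> 's \<Rightarrow> 's) \<Rightarrow> 's set \<Rightarrow> 's set \<Rightarrow> bool" where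
  "is_ideal m S I \<longleftrightarrow> I \<noteq> {} \<and> I \<subseteq> S \<and> (\<forall>a \<in> I. \<forall>s \<in> S. m a s \<in> I \<and> m s a \<in> I)"

definition rank :: "'a set \<Rightarrow> 'a operation set \<Rightarrow> ('a \<Rightarrow> 'a) \<Rightarrow> 'a rel" where
  "rank A F \<alpha> = dim F (\<alpha> ` A)"

definition kernel :: "'a set \<Rightarrow> ('a \<Rightarrow> 'a) \<Rightarrow> 'a rel" where
  "kernel A \<alpha> = {(x, y) \<in> A \<times> A. \<alpha> x = \<alpha> y}"

text \<open>The cardinal \<open>k\<close> may live on any type.\<close>

definition T_below :: "'a set \<Rightarrow> 'a operation set \<Rightarrow> 'a set \<Rightarrow> 'k rel \<Rightarrow> ('a \<Rightarrow> 'a) set" where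
  "T_below A F B k = {\<alpha> \<in> T_semigroup A F B. rank A F \<alpha> <o k}"

text \<open>
  The set over which the minimum defining \<open>r(S)\<close> is taken. The type \<open>'a set rel\<close> contains an
  isomorphic copy of every cardinal that is at most \<open>cardSuc (dim F B)\<close>.
\<close>

definition r_bounds ::
  "'a operation set \<Rightarrow> 'a set \<Rightarrow> ('a \<Rightarrow> 'a) set \<Rightarrow> 'a set rel set" where
  "r_bounds F B S =
     {\<kappa>. Card_order \<kappa> \<and> \<kappa> \<le>o cardSuc (dim F B) \<and> (\<forall>\<alpha> \<in> S. dim F (\<alpha> ` B) <o \<kappa>)}"

text \<open>The minimum exists and is unique up to isomorphism of cardinals.\<close>

definition r_card :: "'a operation set \<Rightarrow> 'a set \<Rightarrow> ('a \<Rightarrow> 'a) set \<Rightarrow> 'a set rel" where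
  "r_card F B S = (SOME \<kappa>. \<kappa> \<in> r_bounds F B S \<and> (\<forall>\<mu> \<in> r_bounds F B S. \<kappa> \<le>o \<mu>))"

definition K_set :: "'a set \<Rightarrow> 'a operation set \<Rightarrow> 'a set \<Rightarrow> ('a \<Rightarrow> 'a) set \<Rightarrow> ('a \<Rightarrow> 'a) set" where
  "K_set A F B S = {\<beta> \<in> T_semigroup A F B. \<exists>\<alpha> \<in> S. kernel A \<alpha> \<subseteq> kernel A \<beta>}"

end

theory Submission
  imports Defs
begin

text \<open>
  The only fact about dimension that is needed is that an independent set inside
  \<open>\<langle>Y\<rangle>\<close> injects into \<open>Y\<close>; a Zorn argument on partial exchanges gives it for all
  cardinalities at once.

  If \<open>ker \<alpha> \<subseteq> ker \<beta>\<close>, choose \<open>\<xi>\<close> sending each element of a basis of \<open>A\<alpha>\<close> to a preimage; then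
  \<open>\<alpha>\<xi>\<alpha> = \<alpha>\<close>, so \<open>\<beta> = \<alpha>(\<xi>\<beta>)\<close> with \<open>\<xi>\<beta> \<in> T(A,B)\<close>. Hence \<open>K(I) = I\<close> for every ideal \<open>I\<close>. If
  \<open>dim(A\<beta>) \<le> dim(B\<alpha>)\<close>, then \<open>\<beta> \<in> T(A,B) \<alpha> T(A,B)\<close>, hence \<open>T\<^bsub>r(I)\<^esub> \<subseteq> I\<close> and
  \<open>I = T\<^bsub>r(I)\<^esub> \<union> K(I)\<close>. Conversely, for \<open>\<beta> \<in> K(S)\<close> the product \<open>\<gamma>\<beta>\<close> has image inside
  \<open>B\<beta>\<close>, whose dimension is below \<open>r(S)\<close>.
\<close>

section \<open>Generated subalgebras\<close>

lemma term_ops_closed: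
  assumes "t \<in> term_ops F n" "closed_under F U" "length xs = n" "set xs \<subseteq> U"
  shows "t xs \<in> U"
  using assms(1)
proof induction
  case (proj i)
  then show ?case using assms by auto
next
  case (comp m f ts)
  then have "set (map (\<lambda>t. t xs) ts) \<subseteq> U" "length (map (\<lambda>t. t xs) ts) = m"
    by auto
  then show ?case using comp.hyps(1) assms(2) unfolding closed_under_def by blast
qed

text \<open>Renaming variables along \<open>\<sigma>\<close> commutes with composition of terms. The
  purpose is to bring terms of different arities to one common arity.\<close>

lemma term_ops_reindex:
  assumes "t \<in> term_ops F n" "\<forall>i<n. \<sigma> i < m"
  shows "(\<lambda>xs. t (map (\<lambda>i. xs ! \<sigma> i) [0..<n])) \<in> term_ops F m"
  using assms(1)
proof induction
  case (proj i)
  then have "(\<lambda>xs::'a list. map (\<lambda>i. xs ! \<sigma> i) [0..<n] ! i) = (\<lambda>xs. xs ! \<sigma> i)"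
    by auto
  then show ?case using proj assms(2) by (simp add: term_ops.proj)
next
  case (comp k f ts)
  let ?r = "\<lambda>t xs. t (map (\<lambda>i. xs ! \<sigma> i) [0..<n])"
  have "(\<lambda>xs. f (map (\<lambda>t. t xs) (map ?r ts))) \<in> term_ops F m"
    using comp by (intro term_ops.comp[of k]) auto
  then show ?case by (simp add: comp_def)
qed

lemma gen_superset: "X \<subseteq> gen F X"
proof
  fix x assume "x \<in> X"
  moreover have "(\<lambda>xs. xs ! 0) \<in> term_ops F 1" by (rule term_ops.proj) simp
  ultimately show "x \<in> gen F X" unfolding gen_def
    by (intro CollectI exI[of _ "\<lambda>xs. xs ! 0"] exI[of _ 1] exI[of _ "[x]"]) simp
qed

lemma gen_base: "x \<in> X \<Longrightarrow> x \<in> gen F X"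
  using gen_superset[of X F] by (rule subsetD)

lemma gen_least:
  assumes "closed_under F U" "X \<subseteq> U"
  shows "gen F X \<subseteq> U"
  using term_ops_closed[OF _ assms(1)] assms(2) unfolding gen_def by blast

lemma gen_mono: "X \<subseteq> Y \<Longrightarrow> gen F X \<subseteq> gen F Y"
  unfolding gen_def by blast

lemma gen_finitary:
  assumes "x \<in> gen F X"
  obtains P where "finite P" "P \<subseteq> X" "x \<in> gen F P"
proof -
  obtain t n xs where "t \<in> term_ops F n" "length xs = n" "set xs \<subseteq> X" "x = t xs"
    using assms unfolding gen_def by blast
  then have "x \<in> gen F (set xs)" unfolding gen_def by blast
  with \<open>set xs \<subseteq> X\<close> show ?thesis using that[of "set xs"] by blast
qed

text \<open>The rule \<open>comp\<close> asks all inner terms to share one arity, whereas each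
  member of \<open>gen F X\<close> comes with its own argument list. Concatenating the lists and
  renumbering the variables reconciles the two.\<close>

lemma gen_common_arguments:
  assumes "set ys \<subseteq> gen F X"
  shows "\<exists>xs ts. set xs \<subseteq> X \<and> set ts \<subseteq> term_ops F (length xs) \<and> ys = map (\<lambda>t. t xs) ts"
  using assms
proof (induction ys)
  case Nil
  show ?case by (intro exI[of _ "[]"]) simp
next
  case (Cons y ys)
  then obtain xs ts where xs: "set xs \<subseteq> X" and ts: "set ts \<subseteq> term_ops F (length xs)"
    and ys: "ys = map (\<lambda>t. t xs) ts" by auto
  from Cons.prems obtain t us where us: "set us \<subseteq> X" and t: "t \<in> term_ops F (length us)"
    and y: "y = t us" unfolding gen_def by auto
  \<comment> \<open>On the argument list \<open>xs @ us\<close>, \<open>?r\<close> feeds a term the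
    first block and \<open>?s\<close> feeds \<open>t\<close> the second, hence the offset
    \<open>length xs\<close>.\<close>
  let ?r = "\<lambda>t zs. t (map (\<lambda>i. zs ! i) [0..<length xs])"
  let ?s = "\<lambda>zs. t (map (\<lambda>i. zs ! (length xs + i)) [0..<length us])"
  have "map (\<lambda>i. (xs @ us) ! i) [0..<length xs] = xs"
    "map (\<lambda>i. (xs @ us) ! (length xs + i)) [0..<length us] = us"
    by (auto intro: nth_equalityI simp: nth_append)
  then have "y # ys = map (\<lambda>t. t (xs @ us)) (?s # map ?r ts)"
    unfolding y ys by simp
  moreover have "?r t' \<in> term_ops F (length (xs @ us))" if "t' \<in> set ts" for t'
    using that ts by (intro term_ops_reindex) auto
  moreover have "?s \<in> term_ops F (length (xs @ us))"
    using t by (intro term_ops_reindex) auto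
  ultimately show ?case using xs us
    by (intro exI[of _ "xs @ us"] exI[of _ "?s # map ?r ts"]) auto
qed

lemma closed_under_gen: "closed_under F (gen F X)"
  unfolding closed_under_def
proof clarify
  fix f and ys :: "'a list"
  assume f: "(length ys, f) \<in> F" and "set ys \<subseteq> gen F X"
  then obtain xs ts where xs: "set xs \<subseteq> X" and ts: "set ts \<subseteq> term_ops F (length xs)"
    and ys: "ys = map (\<lambda>t. t xs) ts" using gen_common_arguments by metis
  have "(\<lambda>zs. f (map (\<lambda>t. t zs) ts)) \<in> term_ops F (length xs)"
    using f ts ys by (intro term_ops.comp[of "length ys"]) auto
  then show "f ys \<in> gen F X"
    using xs unfolding gen_def ys
    by (intro CollectI exI[of _ "\<lambda>zs. f (map (\<lambda>t. t zs) ts)"] exI[of _ "length xs"] exI[of _ xs]) simp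
qed

lemma gen_subset_gen: "X \<subseteq> gen F Y \<Longrightarrow> gen F X \<subseteq> gen F Y"
  by (rule gen_least[OF closed_under_gen])

lemma basis_subset: "is_basis F U X \<Longrightarrow> X \<subseteq> U"
  using gen_superset unfolding is_basis_def by metis

section \<open>Independent sets\<close>

lemma independent_empty: "independent F {}"
  unfolding independent_def by simp

lemma independent_subset: "independent F Y \<Longrightarrow> X \<subseteq> Y \<Longrightarrow> independent F X"
  unfolding independent_def by (meson Diff_mono gen_mono order_refl subsetD)

text \<open>A dependence involves only finitely many elements. This is what carries independence
  over to unions of chains in both Zorn arguments.\<close>

lemma independent_finitary:
  assumes "\<And>P. finite P \<Longrightarrow> P \<subseteq> X \<Longrightarrow> independent F P"
  shows "independent F X"
  unfolding independent_def
proof (intro ballI notI)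
  fix x assume x: "x \<in> X" "x \<in> gen F (X - {x})"
  then obtain P where P: "finite P" "P \<subseteq> X - {x}" "x \<in> gen F P" by (blast elim: gen_finitary)
  then have "independent F (insert x P)" using x by (intro assms) auto
  moreover have "insert x P - {x} = P" using P by blast
  ultimately show False using P unfolding independent_def by auto
qed

locale indep_algebra =
  fixes A :: "'a set" and F :: "'a operation set"
  assumes indep: "independence_algebra A F"
begin

lemma closed_carrier: "closed_under F A"
  using indep unfolding independence_algebra_def is_algebra_def by blast

lemma gen_subset_carrier: "X \<subseteq> A \<Longrightarrow> gen F X \<subseteq> A"
  by (rule gen_least[OF closed_carrier])

lemma exchange:
  "X \<subseteq> A \<Longrightarrow> a \<in> A \<Longrightarrow> b \<in> A \<Longrightarrow> b \<in> gen F (insert a X) \<Longrightarrow> b \<notin> gen F X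
    \<Longrightarrow> a \<in> gen F (insert b X)"
  using indep unfolding independence_algebra_def exchange_property_def by simp

text \<open>If some \<open>z\<close> in \<open>Z\<close> became dependent, the dependence would have
  to involve \<open>y\<close>, and exchanging \<open>z\<close> with \<open>y\<close> would put
  \<open>y\<close> into \<open>gen F Z\<close>.\<close>

lemma independent_insert:
  assumes "independent F Z" "Z \<subseteq> A" "y \<in> A" "y \<notin> gen F Z"
  shows "independent F (insert y Z)"
  unfolding independent_def
proof (intro ballI notI)
  fix z assume z: "z \<in> insert y Z" "z \<in> gen F (insert y Z - {z})"
  have y: "y \<notin> Z" using assms(4) by (meson gen_base)
  show False
  proof (cases "z = y")
    case True
    then show ?thesis using z y assms(4) by simp
  next
    case False
    then have "z \<in> Z" "z \<in> gen F (insert y (Z - {z}))"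
      using z by (auto simp: insert_Diff_if)
    moreover have "z \<notin> gen F (Z - {z})"
      using \<open>z \<in> Z\<close> assms(1) unfolding independent_def by blast
    ultimately have "y \<in> gen F (insert z (Z - {z}))"
      using assms(2,3) by (intro exchange[of "Z - {z}" y z]) auto
    then show False using assms(4) \<open>z \<in> Z\<close> by (simp add: insert_absorb)
  qed
qed

text \<open>A maximal independent \<open>M\<close> between \<open>X\<close> and \<open>U\<close>
  generates \<open>U\<close>, since an element of \<open>U\<close> outside \<open>gen F M\<close>
  could be added by \<open>independent_insert\<close>.\<close>

lemma extend_to_basis:
  assumes "independent F X" "X \<subseteq> U" "closed_under F U" "U \<subseteq> A"
  obtains Z where "X \<subseteq> Z" "is_basis F U Z"
proof -
  let ?\<A> = "{Z. X \<subseteq> Z \<and> Z \<subseteq> U \<and> independent F Z}"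
  have "\<exists>M\<in>?\<A>. \<forall>Z\<in>?\<A>. M \<subseteq> Z \<longrightarrow> Z = M"
  proof (rule subset_Zorn_nonempty)
    show "?\<A> \<noteq> {}" using assms by blast
    fix \<C> assume ne: "\<C> \<noteq> {}" and ch: "subset.chain ?\<A> \<C>"
    have sub: "\<C> \<subseteq> ?\<A>" using ch unfolding subset.chain_def by blast
    have "independent F (\<Union>\<C>)"
    proof (rule independent_finitary)
      fix P assume "finite P" "P \<subseteq> \<Union>\<C>"
      then obtain C where "C \<in> \<C>" "P \<subseteq> C"
        using finite_subset_Union_chain[OF _ _ ne ch] by blast
      then show "independent F P" using sub independent_subset by blast
    qed
    then show "\<Union>\<C> \<in> ?\<A>" using sub ne by blast
  qed
  then obtain M where M: "X \<subseteq> M" "M \<subseteq> U" "independent F M"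
    and max: "\<And>Z. X \<subseteq> Z \<Longrightarrow> Z \<subseteq> U \<Longrightarrow> independent F Z \<Longrightarrow> M \<subseteq> Z \<Longrightarrow> Z = M"
    by auto
  have "y \<in> gen F M" if "y \<in> U" for y
  proof (rule ccontr)
    assume y: "y \<notin> gen F M"
    then have "insert y M = M"
      using M that assms(4) by (intro max independent_insert) auto
    then show False using y by (metis gen_base insertI1)
  qed
  then have "gen F M = U" using gen_least[OF assms(3) M(2)] by blast
  then show ?thesis using that M unfolding is_basis_def by blast
qed

lemma basis_exists:
  assumes "closed_under F U" "U \<subseteq> A"
  obtains X where "is_basis F U X"
  using extend_to_basis[OF independent_empty _ assms] by blast

text \<open>Steinitz exchange for all cardinalities: a maximal partial exchange has all of
  \<open>X\<close> as its domain, so it is an injection into \<open>Y\<close>. As \<open>Y\<close>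
  is an arbitrary subset of \<open>A\<close>, the bound also applies to images of bases, which may
  be dependent.\<close>

lemma independent_card_le:
  assumes X: "independent F X" "X \<subseteq> gen F Y" and Y: "Y \<subseteq> A"
  shows "|X| \<le>o |Y|"
proof -
  \<comment> \<open>\<open>R\<close> is the graph of a partial injection from \<open>X\<close> to \<open>Y\<close>, and \<open>?M R\<close> arises from \<open>X\<close> by replacing
    the elements of its domain by their images.\<close>
  let ?M = "\<lambda>R::('a \<times> 'a) set. (X - Domain R) \<union> Range R"
  let ?\<A> = "{R. R \<subseteq> X \<times> Y \<and> single_valued R \<and> single_valued (R\<inverse>) \<and>
    (X - Domain R) \<inter> Range R = {} \<and> independent F (?M R)}"
  have "\<exists>R\<in>?\<A>. \<forall>Q\<in>?\<A>. R \<subseteq> Q \<longrightarrow> Q = R"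
  proof (rule subset_Zorn_nonempty)
    have "{} \<in> ?\<A>" using X by simp
    then show "?\<A> \<noteq> {}" by blast
    fix \<C> assume ne: "\<C> \<noteq> {}" and ch: "subset.chain ?\<A> \<C>"
    have sub: "\<C> \<subseteq> ?\<A>" using ch unfolding subset.chain_def by blast
    have common: "\<exists>C\<in>\<C>. p \<in> C \<and> q \<in> C" if "p \<in> \<Union>\<C>" "q \<in> \<Union>\<C>" for p q
      using finite_subset_Union_chain[OF _ _ ne ch, of "{p, q}"] that by auto
    have "single_valued (\<Union>\<C>)"
      unfolding single_valued_def
    proof (intro allI impI)
      fix x y z assume "(x, y) \<in> \<Union>\<C>" "(x, z) \<in> \<Union>\<C>"
      then obtain C where "C \<in> \<C>" "(x, y) \<in> C" "(x, z) \<in> C" using common by blast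
      then show "y = z" using sub by (blast dest: single_valuedD)
    qed
    moreover have "single_valued ((\<Union>\<C>)\<inverse>)"
      unfolding single_valued_def
    proof (intro allI impI)
      fix x y z assume "(x, y) \<in> (\<Union>\<C>)\<inverse>" "(x, z) \<in> (\<Union>\<C>)\<inverse>"
      then obtain C where "C \<in> \<C>" "(x, y) \<in> C\<inverse>" "(x, z) \<in> C\<inverse>"
        using common[of "(y, x)" "(z, x)"] by auto
      then show "y = z" using sub by (blast dest: single_valuedD)
    qed
    moreover have "(X - Domain (\<Union>\<C>)) \<inter> Range (\<Union>\<C>) = {}"
      using sub by blast
    moreover have "independent F (?M (\<Union>\<C>))"
    proof (rule independent_finitary)
      fix P assume P: "finite P" "P \<subseteq> ?M (\<Union>\<C>)"
      \<comment> \<open>Picking one pair for each of the finitely many points of \<open>P\<close> in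
        the range places these points in the range of a single member \<open>C\<close> of the chain.
        The other points of \<open>P\<close> avoid the domain of the union, hence that of
        \<open>C\<close>.\<close>
      then have "\<forall>p \<in> P \<inter> Range (\<Union>\<C>). \<exists>q. (q, p) \<in> \<Union>\<C>" by blast
      then obtain q where q: "\<And>p. p \<in> P \<inter> Range (\<Union>\<C>) \<Longrightarrow> (q p, p) \<in> \<Union>\<C>" by metis
      have "finite ((\<lambda>p. (q p, p)) ` (P \<inter> Range (\<Union>\<C>)))" using P by simp
      moreover have "(\<lambda>p. (q p, p)) ` (P \<inter> Range (\<Union>\<C>)) \<subseteq> \<Union>\<C>" using q by blast
      ultimately obtain C where C: "C \<in> \<C>" "(\<lambda>p. (q p, p)) ` (P \<inter> Range (\<Union>\<C>)) \<subseteq> C"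
        using finite_subset_Union_chain[OF _ _ ne ch] by metis
      have "P \<subseteq> ?M C"
      proof
        fix p assume p: "p \<in> P"
        show "p \<in> ?M C"
        proof (cases "p \<in> Range (\<Union>\<C>)")
          case True
          then show ?thesis using p C by blast
        next
          case False
          then show ?thesis using p P C by blast
        qed
      qed
      moreover have "independent F (?M C)" using C(1) sub by blast
      ultimately show "independent F P" using independent_subset by metis
    qed
    ultimately show "\<Union>\<C> \<in> ?\<A>" using sub by blast
  qed
  then obtain R where R: "R \<in> ?\<A>" and max: "\<forall>Q\<in>?\<A>. R \<subseteq> Q \<longrightarrow> Q = R"
    by (rule bexE)
  have "X \<subseteq> Domain R"
  proof (rule ccontr)
    assume "\<not> X \<subseteq> Domain R"
    then obtain x where x: "x \<in> X" "x \<notin> Domain R" by blast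
    let ?Z = "?M R - {x}"
    have XA: "X \<subseteq> A" using X(2) gen_subset_carrier[OF Y] by blast
    have Z: "independent F ?Z" "?Z \<subseteq> A"
      using R XA Y independent_subset[of F "?M R" ?Z] by auto
    have "x \<notin> gen F ?Z" using R x unfolding independent_def by blast
    \<comment> \<open>Otherwise \<open>x\<close>, which lies in \<open>gen F Y\<close>, would lie in
      \<open>gen F ?Z\<close>. So some \<open>y\<close> in \<open>Y\<close> can take the place of
      \<open>x\<close>.\<close>
    then have "\<not> Y \<subseteq> gen F ?Z" using gen_subset_gen[of Y F ?Z] X(2) x(1) by blast
    then obtain y where y: "y \<in> Y" "y \<notin> gen F ?Z" by blast
    have yZ: "y \<notin> ?Z" using y(2) by (meson gen_base)
    \<comment> \<open>By the disjointness clause of the Zorn family, an element not yet exchanged is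
      not an image. Hence \<open>Range R\<close> lies in \<open>?Z\<close>, so \<open>y\<close> is a
      new image and injectivity survives.\<close>
    have xR: "x \<notin> Range R" using R x by blast
    have M: "?M (insert (x, y) R) = insert y ?Z" using x xR by auto
    have "insert (x, y) R \<in> ?\<A>"
    proof (intro CollectI conjI)
      show "insert (x, y) R \<subseteq> X \<times> Y" using R x y by blast
      show "single_valued (insert (x, y) R)"
        using R x unfolding single_valued_def by blast
      have "y \<notin> Range R" using yZ xR by blast
      then show "single_valued ((insert (x, y) R)\<inverse>)"
        using R unfolding single_valued_def by blast
      show "(X - Domain (insert (x, y) R)) \<inter> Range (insert (x, y) R) = {}"
        using R yZ by auto
      show "independent F (?M (insert (x, y) R))"
        unfolding M using independent_insert[OF Z] y Y by blast
    qed
    then have "insert (x, y) R = R" by (rule max[rule_format]) (rule subset_insertI)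
    then show False using x by blast
  qed
  then have "\<forall>x\<in>X. \<exists>y. (x, y) \<in> R" by blast
  then obtain f where f: "\<And>x. x \<in> X \<Longrightarrow> (x, f x) \<in> R" by metis
  have "inj_on f X"
  proof (rule inj_onI)
    fix x x' assume "x \<in> X" "x' \<in> X" "f x = f x'"
    then have "(f x, x) \<in> R\<inverse>" "(f x, x') \<in> R\<inverse>" using f[of x] f[of x'] by auto
    then show "x = x'" using R single_valuedD[of "R\<inverse>"] by blast
  qed
  moreover have "f ` X \<subseteq> Y" using f R by blast
  ultimately show ?thesis using card_of_ordLeq by blast
qed

section \<open>Dimension\<close>

text \<open>The basis returned is the one picked by \<open>SOME\<close> in \<open>dim\<close>, so
  the equality with \<open>|X|\<close> is literal and equipotence of bases is not invoked.\<close>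

lemma dim_basis:
  assumes "closed_under F U" "U \<subseteq> A"
  obtains X where "is_basis F U X" "dim F U = |X|"
  using basis_exists[OF assms] someI[of "is_basis F U"] unfolding dim_def by metis

lemma dim_mono:
  assumes "closed_under F U" "U \<subseteq> V" "closed_under F V" "V \<subseteq> A"
  shows "dim F U \<le>o dim F V"
proof -
  obtain X where X: "is_basis F U X" "dim F U = |X|" using dim_basis assms by blast
  obtain Y where Y: "is_basis F V Y" "dim F V = |Y|" using dim_basis assms by blast
  have "X \<subseteq> U" "Y \<subseteq> V"
    using basis_subset[OF X(1)] basis_subset[OF Y(1)] by auto
  then have "|X| \<le>o |Y|"
    using X Y assms unfolding is_basis_def by (intro independent_card_le) auto
  then show ?thesis using X Y by simp
qed

section \<open>Endomorphisms\<close>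

lemma endo_op:
  "\<alpha> \<in> endomorphisms A F \<Longrightarrow> (n, f) \<in> F \<Longrightarrow> length xs = n \<Longrightarrow> set xs \<subseteq> A
    \<Longrightarrow> \<alpha> (f xs) = f (map \<alpha> xs)"
  unfolding endomorphisms_def by blast

lemma endo_in: "\<alpha> \<in> endomorphisms A F \<Longrightarrow> x \<in> A \<Longrightarrow> \<alpha> x \<in> A"
  unfolding endomorphisms_def by auto

lemma closed_under_image:
  assumes "\<alpha> \<in> endomorphisms A F" "closed_under F U" "U \<subseteq> A"
  shows "closed_under F (\<alpha> ` U)"
  unfolding closed_under_def
proof clarify
  fix f and ys :: "'a list"
  assume f: "(length ys, f) \<in> F" and "set ys \<subseteq> \<alpha> ` U"
  then have "ys \<in> map \<alpha> ` lists U" by (auto simp flip: lists_image)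
  then obtain xs where xs: "set xs \<subseteq> U" "ys = map \<alpha> xs" by auto
  then have "f ys = \<alpha> (f xs)" using endo_op[OF assms(1) f] assms(3) by auto
  moreover have "f xs \<in> U" using assms(2) f xs unfolding closed_under_def by fastforce
  ultimately show "f ys \<in> \<alpha> ` U" by blast
qed

text \<open>With \<open>gen_least\<close>, this turns agreement on generators into agreement on the
  generated subalgebra.\<close>

lemma closed_under_equalizer:
  assumes "\<alpha> \<in> endomorphisms A F" "\<beta> \<in> endomorphisms A F"
  shows "closed_under F {x \<in> A. \<alpha> x = \<beta> x}"
  unfolding closed_under_def
proof clarify
  fix f and xs :: "'a list"
  assume f: "(length xs, f) \<in> F" and xs: "set xs \<subseteq> {x \<in> A. \<alpha> x = \<beta> x}"
  then have eq: "map \<alpha> xs = map \<beta> xs" and A: "set xs \<subseteq> A" by auto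
  have "\<alpha> (f xs) = \<beta> (f xs)"
    unfolding endo_op[OF assms(1) f refl A] endo_op[OF assms(2) f refl A] eq ..
  moreover have "f xs \<in> A"
    using closed_carrier f A unfolding closed_under_def by blast
  ultimately show "f xs \<in> A \<and> \<alpha> (f xs) = \<beta> (f xs)" by blast
qed

lemma closed_under_vimage:
  assumes "\<alpha> \<in> endomorphisms A F" "closed_under F U"
  shows "closed_under F {x \<in> A. \<alpha> x \<in> U}"
  unfolding closed_under_def
proof clarify
  fix f and xs :: "'a list"
  assume f: "(length xs, f) \<in> F" and xs: "set xs \<subseteq> {x \<in> A. \<alpha> x \<in> U}"
  then have "set (map \<alpha> xs) \<subseteq> U" "length (map \<alpha> xs) = length xs" "set xs \<subseteq> A" by auto
  then have "f (map \<alpha> xs) \<in> U" "f xs \<in> A"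
    using assms(2) closed_carrier f unfolding closed_under_def by blast+
  then show "f xs \<in> A \<and> \<alpha> (f xs) \<in> U" using endo_op[OF assms(1) f] \<open>set xs \<subseteq> A\<close> by simp
qed

lemma image_gen_subset:
  assumes "\<alpha> \<in> endomorphisms A F" "X \<subseteq> A"
  shows "\<alpha> ` gen F X \<subseteq> gen F (\<alpha> ` X)"
proof -
  have "gen F X \<subseteq> {x \<in> A. \<alpha> x \<in> gen F (\<alpha> ` X)}"
    using assms gen_superset[of "\<alpha> ` X" F]
    by (intro gen_least closed_under_vimage closed_under_gen) auto
  then show ?thesis by blast
qed

lemma endo_eq_on_gen:
  assumes "\<alpha> \<in> endomorphisms A F" "\<beta> \<in> endomorphisms A F" "X \<subseteq> A"
    and "\<And>x. x \<in> X \<Longrightarrow> \<alpha> x = \<beta> x" and "y \<in> gen F X"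
  shows "\<alpha> y = \<beta> y"
  using gen_least[OF closed_under_equalizer[OF assms(1,2)], of X] assms(3-5) by blast

lemma endo_id: "restrict id A \<in> endomorphisms A F"
proof -
  have "restrict id A (f xs) = f (map (restrict id A) xs)"
    if "(n, f) \<in> F" "length xs = n" "set xs \<subseteq> A" for n f xs
  proof -
    have "f xs \<in> A" using closed_carrier that unfolding closed_under_def by blast
    moreover have "map (restrict id A) xs = xs" using that by (intro map_idI) auto
    ultimately show ?thesis by simp
  qed
  moreover have "restrict id A \<in> A \<rightarrow>\<^sub>E A" by auto
  ultimately show ?thesis unfolding endomorphisms_def by blast
qed

lemma mult_apply: "x \<in> A \<Longrightarrow> mult A \<alpha> \<beta> x = \<beta> (\<alpha> x)"
  unfolding mult_def compose_def by simp

lemma endo_mult: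
  assumes "\<alpha> \<in> endomorphisms A F" "\<beta> \<in> endomorphisms A F"
  shows "mult A \<alpha> \<beta> \<in> endomorphisms A F"
proof -
  have "mult A \<alpha> \<beta> (f xs) = f (map (mult A \<alpha> \<beta>) xs)"
    if f: "(n, f) \<in> F" "length xs = n" "set xs \<subseteq> A" for n f xs
  proof -
    have "f xs \<in> A" using closed_carrier f unfolding closed_under_def by blast
    then have "mult A \<alpha> \<beta> (f xs) = \<beta> (f (map \<alpha> xs))"
      using endo_op[OF assms(1) f] by (simp add: mult_apply)
    also have "\<dots> = f (map \<beta> (map \<alpha> xs))"
      using f endo_in[OF assms(1)] by (intro endo_op[OF assms(2) f(1)]) auto
    also have "map \<beta> (map \<alpha> xs) = map (mult A \<alpha> \<beta>) xs"
      using f(3) by (auto simp: mult_apply)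
    finally show ?thesis .
  qed
  moreover have "mult A \<alpha> \<beta> \<in> A \<rightarrow>\<^sub>E A"
    using endo_in assms unfolding mult_def compose_def by auto
  ultimately show ?thesis unfolding endomorphisms_def by blast
qed

lemma endo_eqI:
  assumes "\<alpha> \<in> endomorphisms A F" "\<beta> \<in> endomorphisms A F" "\<And>x. x \<in> A \<Longrightarrow> \<alpha> x = \<beta> x"
  shows "\<alpha> = \<beta>"
  using assms unfolding endomorphisms_def by (auto intro: PiE_ext)

text \<open>The free basis property concerns bases of the whole algebra and maps into
  \<open>A\<close>. This version starts from an independent set and controls the range, as
  membership in T(A,B) demands.\<close>

lemma free_extension:
  assumes "independent F X" "X \<subseteq> A" "closed_under F C" "C \<subseteq> A" "C \<noteq> {}" "g \<in> X \<rightarrow> C"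
  obtains \<gamma> where "\<gamma> \<in> endomorphisms A F" "\<gamma> ` A \<subseteq> C" "\<And>x. x \<in> X \<Longrightarrow> \<gamma> x = g x"
proof -
  obtain c where c: "c \<in> C" using assms by blast
  obtain Z where Z: "X \<subseteq> Z" "is_basis F A Z"
    using extend_to_basis[OF assms(1,2) closed_carrier] by blast
  \<comment> \<open>The default value \<open>c\<close> on the new basis elements keeps the whole
    image inside \<open>C\<close>.\<close>
  let ?g = "\<lambda>x. if x \<in> X then g x else c"
  have gC: "?g x \<in> C" for x using assms(6) c by auto
  then have "?g \<in> Z \<rightarrow> A" using assms(4) by blast
  then obtain \<gamma> where \<gamma>: "\<gamma> \<in> endomorphisms A F" "\<And>x. x \<in> Z \<Longrightarrow> \<gamma> x = ?g x"
    using indep Z(2) unfolding independence_algebra_def free_basis_property_def by blast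
  have ZA: "Z \<subseteq> A" and gZ: "gen F Z = A"
    using Z(2) basis_subset[OF Z(2)] unfolding is_basis_def by auto
  have "\<gamma> ` Z \<subseteq> C"
  proof
    fix y assume "y \<in> \<gamma> ` Z"
    then obtain x where "x \<in> Z" "y = \<gamma> x" by blast
    then show "y \<in> C" using \<gamma>(2) gC[of x] by simp
  qed
  then have "\<gamma> ` A \<subseteq> C"
    using image_gen_subset[OF \<gamma>(1) ZA] gZ gen_least[OF assms(3)] by blast
  moreover have "\<gamma> x = g x" if "x \<in> X" for x using that Z(1) \<gamma>(2)[of x] by auto
  ultimately show ?thesis using that \<gamma>(1) by blast
qed

text \<open>The image of a basis of \<open>U\<close> generates the image of \<open>U\<close>; even
  if dependent, it bounds the size of independent sets there.\<close>

lemma dim_image_le: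
  assumes "\<alpha> \<in> endomorphisms A F" "closed_under F U" "U \<subseteq> A"
  shows "dim F (\<alpha> ` U) \<le>o dim F U"
proof -
  have im: "closed_under F (\<alpha> ` U)" "\<alpha> ` U \<subseteq> A"
    using closed_under_image[OF assms] endo_in[OF assms(1)] assms(3) by auto
  obtain X where X: "is_basis F (\<alpha> ` U) X" "dim F (\<alpha> ` U) = |X|" using dim_basis[OF im] by blast
  obtain Y where Y: "is_basis F U Y" "dim F U = |Y|" using dim_basis[OF assms(2,3)] by blast
  have "X \<subseteq> \<alpha> ` U" "Y \<subseteq> U"
    using basis_subset[OF X(1)] basis_subset[OF Y(1)] by auto
  moreover from this have "\<alpha> ` U \<subseteq> gen F (\<alpha> ` Y)"
    using image_gen_subset[OF assms(1), of Y] Y assms(3) unfolding is_basis_def by auto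
  ultimately have "|X| \<le>o |\<alpha> ` Y|"
    using X im(2) assms(3) endo_in[OF assms(1)] unfolding is_basis_def
    by (intro independent_card_le) auto
  then show ?thesis using X Y card_of_image ordLeq_transitive by metis
qed

text \<open>This is von Neumann regularity of the endomorphism monoid. The map \<open>\<xi>\<close>
  may leave \<open>B\<close>, so it is only claimed to be an endomorphism.\<close>

lemma section_exists:
  assumes \<alpha>: "\<alpha> \<in> endomorphisms A F"
  obtains \<xi> where "\<xi> \<in> endomorphisms A F" "\<And>x. x \<in> A \<Longrightarrow> \<alpha> (\<xi> (\<alpha> x)) = \<alpha> x"
proof -
  have im: "closed_under F (\<alpha> ` A)" "\<alpha> ` A \<subseteq> A"
    using closed_under_image[OF \<alpha> closed_carrier] endo_in[OF \<alpha>] by auto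
  obtain Y where Y: "is_basis F (\<alpha> ` A) Y" using basis_exists[OF im] .
  have Ysub: "Y \<subseteq> \<alpha> ` A" using Y by (rule basis_subset)
  define g where "g = (\<lambda>y. SOME x. x \<in> A \<and> \<alpha> x = y)"
  have g: "g y \<in> A \<and> \<alpha> (g y) = y" if "y \<in> Y" for y
  proof -
    have "\<exists>x. x \<in> A \<and> \<alpha> x = y" using Ysub that by blast
    then show ?thesis unfolding g_def by (rule someI_ex)
  qed
  have ne: "A \<noteq> {}" using indep unfolding independence_algebra_def is_algebra_def by blast
  have "independent F Y" "Y \<subseteq> A" using Y Ysub im(2) unfolding is_basis_def by auto
  moreover have "g \<in> Y \<rightarrow> A" using g by blast
  ultimately obtain \<xi> where \<xi>: "\<xi> \<in> endomorphisms A F" "\<And>y. y \<in> Y \<Longrightarrow> \<xi> y = g y"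
    using free_extension closed_carrier ne by blast
  \<comment> \<open>Applying \<open>\<xi>\<close> and then \<open>\<alpha>\<close> fixes every
    element of the basis \<open>Y\<close>, hence everything in the image of
    \<open>\<alpha>\<close>.\<close>
  have "mult A \<xi> \<alpha> z = restrict id A z" if "z \<in> \<alpha> ` A" for z
  proof (rule endo_eq_on_gen[of "mult A \<xi> \<alpha>" "restrict id A" Y])
    show "mult A \<xi> \<alpha> \<in> endomorphisms A F" using \<xi> \<alpha> by (intro endo_mult)
    show "restrict id A \<in> endomorphisms A F" by (rule endo_id)
    show "Y \<subseteq> A" using Ysub im by blast
    then show "mult A \<xi> \<alpha> y = restrict id A y" if "y \<in> Y" for y
      using that \<xi> g by (simp add: mult_apply subsetD)
    show "z \<in> gen F Y" using that Y unfolding is_basis_def by blast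
  qed
  then have "\<alpha> (\<xi> (\<alpha> x)) = \<alpha> x" if "x \<in> A" for x
    using that endo_in[OF \<alpha>] by (force simp: mult_apply)
  then show ?thesis using that \<xi> by blast
qed

end

section \<open>The semigroup of endomorphisms with restricted range\<close>

locale restricted_range = indep_algebra +
  fixes B :: "'a set"
  assumes sub: "subalgebra A F B" and ne: "B \<noteq> {}"
begin

abbreviation "T \<equiv> T_semigroup A F B"

lemma B_closed: "closed_under F B" and B_subset: "B \<subseteq> A"
  using sub unfolding subalgebra_def by auto

lemma T_endo: "\<alpha> \<in> T \<Longrightarrow> \<alpha> \<in> endomorphisms A F"
  and T_in: "\<alpha> \<in> T \<Longrightarrow> x \<in> A \<Longrightarrow> \<alpha> x \<in> B"
  and T_image: "\<alpha> \<in> T \<Longrightarrow> \<alpha> ` A \<subseteq> B"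
  unfolding T_semigroup_def by auto

text \<open>The last map applied decides the range. This admits products \<open>\<xi>\<beta>\<close>
  in which only \<open>\<beta>\<close> has range in \<open>B\<close>.\<close>

lemma mult_T_right:
  assumes "\<alpha> \<in> endomorphisms A F" "\<beta> \<in> T"
  shows "mult A \<alpha> \<beta> \<in> T"
  using endo_mult[OF assms(1) T_endo[OF assms(2)]] T_in[OF assms(2)] endo_in[OF assms(1)]
  unfolding T_semigroup_def by (auto simp: mult_apply)

lemma mult_T: "\<alpha> \<in> T \<Longrightarrow> \<beta> \<in> T \<Longrightarrow> mult A \<alpha> \<beta> \<in> T"
  by (simp add: mult_T_right T_endo)

lemma T_image_A: "\<alpha> \<in> T \<Longrightarrow> closed_under F (\<alpha> ` A)" "\<alpha> \<in> T \<Longrightarrow> \<alpha> ` A \<subseteq> A"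
  using closed_under_image[OF T_endo closed_carrier] T_image B_subset by blast+

lemma T_image_B: "\<alpha> \<in> T \<Longrightarrow> closed_under F (\<alpha> ` B)" "\<alpha> \<in> T \<Longrightarrow> \<alpha> ` B \<subseteq> B"
  using closed_under_image[OF T_endo B_closed] T_image B_subset by blast+

section \<open>Factorisations inside T(A,B)\<close>

text \<open>Take \<open>\<gamma> = \<xi>\<beta>\<close> with \<open>\<xi>\<close> from
  \<open>section_exists\<close>: the elements \<open>\<xi> (\<alpha> x)\<close> and \<open>x\<close>
  agree under \<open>\<alpha>\<close>, hence also under \<open>\<beta>\<close>.\<close>

lemma kernel_factor:
  assumes "\<alpha> \<in> T" "\<beta> \<in> T" "kernel A \<alpha> \<subseteq> kernel A \<beta>"
  obtains \<gamma> where "\<gamma> \<in> T" "\<beta> = mult A \<alpha> \<gamma>"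
proof -
  obtain \<xi> where \<xi>: "\<xi> \<in> endomorphisms A F" "\<And>x. x \<in> A \<Longrightarrow> \<alpha> (\<xi> (\<alpha> x)) = \<alpha> x"
    using section_exists[OF T_endo[OF assms(1)]] by blast
  have \<gamma>: "mult A \<xi> \<beta> \<in> T" using \<xi> assms by (intro mult_T_right)
  have "\<beta> = mult A \<alpha> (mult A \<xi> \<beta>)"
  proof (rule endo_eqI)
    show "\<beta> \<in> endomorphisms A F" "mult A \<alpha> (mult A \<xi> \<beta>) \<in> endomorphisms A F"
      using \<gamma> assms by (auto intro: T_endo endo_mult)
    fix x assume x: "x \<in> A"
    then have A: "\<alpha> x \<in> A" "\<xi> (\<alpha> x) \<in> A"
      using \<xi> endo_in T_endo[OF assms(1)] by auto
    then have "(\<xi> (\<alpha> x), x) \<in> kernel A \<alpha>" using x \<xi> unfolding kernel_def by simp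
    then have "\<beta> (\<xi> (\<alpha> x)) = \<beta> x" using assms(3) unfolding kernel_def by blast
    then show "\<beta> x = mult A \<alpha> (mult A \<xi> \<beta>) x" using x A by (simp add: mult_apply)
  qed
  then show ?thesis using that \<gamma> by blast
qed

text \<open>Embed a basis \<open>Y\<close> of the image of \<open>\<beta>\<close> into a basis of
  \<open>\<alpha>\<close>
  B\<open>by\<close>h\<open>. Let\<close>\<zeta>\<open>send\<close>y\<open>to a preimage of\<close>h
  y\<open>under\<close>\<alpha>\<open>, and let\<close>\<delta>\<open>undo\<close>h\<open>. The preimages must lie in\<close>B\<open>for\<close>\<zeta>\<open>to be in\<close>T\<open>, which is why\<close>dim
  F (\<alpha> \<open>B)\<close> appears and not the rank of \<open>\<alpha>\<close>.\<close>

lemma rank_factor: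
  assumes \<alpha>: "\<alpha> \<in> T" and \<beta>: "\<beta> \<in> T" and le: "rank A F \<beta> \<le>o dim F (\<alpha> ` B)"
  obtains \<gamma> \<delta> where "\<gamma> \<in> T" "\<delta> \<in> T" "\<beta> = mult A (mult A \<gamma> \<alpha>) \<delta>"
proof -
  have BA: "\<alpha> ` B \<subseteq> A" using T_image_B[OF \<alpha>] B_subset by blast
  obtain Y where Y: "is_basis F (\<beta> ` A) Y" "dim F (\<beta> ` A) = |Y|"
    using dim_basis[OF T_image_A[OF \<beta>]] .
  obtain W where W: "is_basis F (\<alpha> ` B) W" "dim F (\<alpha> ` B) = |W|"
    using dim_basis[OF T_image_B(1)[OF \<alpha>] BA] .
  have Ysub: "Y \<subseteq> \<beta> ` A" and Wsub: "W \<subseteq> \<alpha> ` B"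
    using basis_subset[OF Y(1)] basis_subset[OF W(1)] by auto
  have YB: "Y \<subseteq> B" and YA: "Y \<subseteq> A" using Ysub T_image[OF \<beta>] B_subset by blast+
  have "|Y| \<le>o |W|" using le Y W unfolding rank_def by simp
  then obtain h where h: "inj_on h Y" "h ` Y \<subseteq> W" using card_of_ordLeq by metis
  have "h ` Y \<subseteq> \<alpha> ` B" using h(2) Wsub by (rule subset_trans)
  then have "\<exists>z. z \<in> B \<and> \<alpha> z = h y" if "y \<in> Y" for y
    using that by (metis image_eqI imageE subsetD)
  then obtain z where z: "\<And>y. y \<in> Y \<Longrightarrow> z y \<in> B \<and> \<alpha> (z y) = h y" by metis
  obtain \<zeta> where \<zeta>: "\<zeta> \<in> endomorphisms A F" "\<zeta> ` A \<subseteq> B" "\<And>y. y \<in> Y \<Longrightarrow> \<zeta> y = z y"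
    using free_extension[OF _ YA B_closed B_subset ne, of z] z Y unfolding is_basis_def by auto
  have hY: "independent F (h ` Y)"
    using W(1) h(2) independent_subset unfolding is_basis_def by metis
  have hYA: "h ` Y \<subseteq> A" using \<open>h ` Y \<subseteq> \<alpha> ` B\<close> BA by (rule subset_trans)
  have "inv_into Y h \<in> h ` Y \<rightarrow> B" 
    by (rule funcsetI) (rule subsetD[OF YB inv_into_into])
  from free_extension[OF hY hYA B_closed B_subset ne this]
  obtain \<delta> where \<delta>: "\<delta> \<in> endomorphisms A F" "\<delta> ` A \<subseteq> B"
    "\<And>w. w \<in> h ` Y \<Longrightarrow> \<delta> w = inv_into Y h w" by blast
  have T: "\<zeta> \<in> T" "\<delta> \<in> T" using \<zeta> \<delta> unfolding T_semigroup_def by auto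
  \<comment> \<open>On \<open>Y\<close> this composite runs from \<open>y\<close> to
    \<open>z y\<close> to \<open>h y\<close> and back to \<open>y\<close>, so it fixes the image of
    \<open>\<beta>\<close> pointwise and may be appended to \<open>\<beta>\<close>.\<close>
  let ?\<eta> = "mult A (mult A \<zeta> \<alpha>) \<delta>"
  have \<eta>: "?\<eta> v = restrict id A v" if "v \<in> \<beta> ` A" for v
  proof (rule endo_eq_on_gen[of ?\<eta> "restrict id A" Y])
    show "?\<eta> \<in> endomorphisms A F" using T \<alpha> by (intro T_endo mult_T)
    show "restrict id A \<in> endomorphisms A F" by (rule endo_id)
    show "Y \<subseteq> A" by (rule YA)
    show "?\<eta> y = restrict id A y" if "y \<in> Y" for y
      using that YA z \<zeta> \<delta> h by (auto simp: mult_apply)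
    show "v \<in> gen F Y" using that Y unfolding is_basis_def by blast
  qed
  have "\<beta> = mult A (mult A (mult A \<beta> \<zeta>) \<alpha>) \<delta>"
  proof (rule endo_eqI)
    show "\<beta> \<in> endomorphisms A F" "mult A (mult A (mult A \<beta> \<zeta>) \<alpha>) \<delta> \<in> endomorphisms A F"
      using \<alpha> \<beta> T by (auto intro: T_endo mult_T)
    fix x assume x: "x \<in> A"
    then have "\<beta> x \<in> A" using endo_in T_endo[OF \<beta>] by blast
    then show "\<beta> x = mult A (mult A (mult A \<beta> \<zeta>) \<alpha>) \<delta> x"
      using \<eta>[of "\<beta> x"] x by (simp add: mult_apply)
  qed
  then show ?thesis using that[of "mult A \<beta> \<zeta>" \<delta>] T \<beta> by (simp add: mult_T)
qed

section \<open>Bounds on ranks and dimensions of images\<close>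

text \<open>Writing \<open>\<beta>\<close> as \<open>\<alpha>\<close> followed by
  \<open>\<gamma>\<close> makes \<open>\<beta>\<close> B\<open>an image of\<close>\<alpha>
  \<open>B\<close>.\<close>

lemma dim_kernel_le:
  assumes "\<alpha> \<in> T" "\<beta> \<in> T" "kernel A \<alpha> \<subseteq> kernel A \<beta>"
  shows "dim F (\<beta> ` B) \<le>o dim F (\<alpha> ` B)"
proof -
  obtain \<gamma> where \<gamma>: "\<gamma> \<in> T" "\<beta> = mult A \<alpha> \<gamma>" using kernel_factor[OF assms] .
  have "\<beta> ` B = \<gamma> ` (\<alpha> ` B)" unfolding \<gamma>(2) image_image
    using B_subset by (intro image_cong) (auto simp: mult_apply)
  moreover have "\<alpha> ` B \<subseteq> A" using T_image_B[OF assms(1)] B_subset by blast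
  ultimately show ?thesis
    using dim_image_le[OF T_endo[OF \<gamma>(1)] T_image_B(1)[OF assms(1)]] by simp
qed

lemma rank_mult_le:
  assumes "\<alpha> \<in> T" "\<beta> \<in> T"
  shows "rank A F (mult A \<alpha> \<beta>) \<le>o rank A F \<alpha>" "rank A F (mult A \<alpha> \<beta>) \<le>o dim F (\<beta> ` B)"
proof -
  have im: "mult A \<alpha> \<beta> ` A = \<beta> ` (\<alpha> ` A)"
    unfolding image_image by (intro image_cong) (auto simp: mult_apply)
  show "rank A F (mult A \<alpha> \<beta>) \<le>o rank A F \<alpha>"
    unfolding rank_def im by (rule dim_image_le[OF T_endo[OF assms(2)] T_image_A[OF assms(1)]])
  have "closed_under F (\<beta> ` \<alpha> ` A)"
    using im T_image_A(1)[OF mult_T[OF assms]] by simp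
  then show "rank A F (mult A \<alpha> \<beta>) \<le>o dim F (\<beta> ` B)"
    unfolding rank_def im using T_image[OF assms(1)] T_image_B[OF assms(2)] B_subset
    by (intro dim_mono) auto
qed

lemma dim_image_B_le_rank: "\<alpha> \<in> T \<Longrightarrow> dim F (\<alpha> ` B) \<le>o rank A F \<alpha>"
  unfolding rank_def using B_subset T_image_A T_image_B by (intro dim_mono) auto

section \<open>The cardinal r(S) and the description of ideals\<close>

text \<open>The successor of \<open>dim F B\<close> is itself an admissible bound, as images of
  \<open>B\<close> have dimension at most \<open>dim F B\<close>. Well-ordering of cardinals then
  yields the minimum that \<open>SOME\<close> selects.\<close>

lemma r_card_least:
  assumes "S \<subseteq> T"
  shows "r_card F B S \<in> r_bounds F B S" "\<And>\<mu>. \<mu> \<in> r_bounds F B S \<Longrightarrow> r_card F B S \<le>o \<mu>"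
proof -
  have c: "Card_order (dim F B)" unfolding dim_def by (rule card_of_Card_order)
  have "dim F (\<alpha> ` B) <o cardSuc (dim F B)" if "\<alpha> \<in> S" for \<alpha>
  proof -
    have "\<alpha> \<in> T" using that assms by blast
    then have "dim F (\<alpha> ` B) \<le>o dim F B" by (intro dim_image_le T_endo B_closed B_subset)
    then show ?thesis using c cardSuc_greater ordLeq_ordLess_trans by blast
  qed
  then have "cardSuc (dim F B) \<in> r_bounds F B S"
    unfolding r_bounds_def using cardSuc_Card_order[OF c] card_order_on_well_order_on ordLeq_reflexive by blast
  then have "\<exists>\<kappa>\<in>r_bounds F B S. \<forall>\<mu>\<in>r_bounds F B S. \<kappa> \<le>o \<mu>"
    by (intro exists_minim_Well_order) (auto simp: r_bounds_def card_order_on_def)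
  then have "\<exists>\<kappa>. \<kappa> \<in> r_bounds F B S \<and> (\<forall>\<mu>\<in>r_bounds F B S. \<kappa> \<le>o \<mu>)" by blast
  from someI_ex[OF this]
  show "r_card F B S \<in> r_bounds F B S" "\<And>\<mu>. \<mu> \<in> r_bounds F B S \<Longrightarrow> r_card F B S \<le>o \<mu>"
    unfolding r_card_def by blast+
qed

text \<open>The cardinal \<open>k\<close> stays arbitrary, and of arbitrary type, so that one proof
  serves both families: \<open>r_card F B S\<close> and its \<open>cardSuc\<close> have different
  types.\<close>

lemma ideal_union:
  fixes k :: "'k rel"
  assumes S: "S \<noteq> {}" "S \<subseteq> T" and k: "\<And>\<alpha>. \<alpha> \<in> S \<Longrightarrow> dim F (\<alpha> ` B) <o k"
  shows "is_ideal (mult A) T (T_below A F B k \<union> K_set A F B S)"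
proof -
  let ?I = "T_below A F B k \<union> K_set A F B S"
  have "S \<subseteq> K_set A F B S" using S unfolding K_set_def by blast
  then have "?I \<noteq> {}" using S(1) by blast
  moreover have "?I \<subseteq> T" unfolding T_below_def K_set_def by blast
  moreover have "mult A \<beta> \<gamma> \<in> ?I \<and> mult A \<gamma> \<beta> \<in> ?I" if \<beta>: "\<beta> \<in> ?I" and \<gamma>: "\<gamma> \<in> T" for \<beta> \<gamma>
  proof -
    have \<beta>T: "\<beta> \<in> T" using \<beta> \<open>?I \<subseteq> T\<close> by blast
    have m: "mult A \<beta> \<gamma> \<in> T" "mult A \<gamma> \<beta> \<in> T" using \<beta>T \<gamma> mult_T by auto
    have r: "rank A F (mult A \<gamma> \<beta>) \<le>o dim F (\<beta> ` B)" by (rule rank_mult_le(2)[OF \<gamma> \<beta>T])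
    show ?thesis
    proof (cases "rank A F \<beta> <o k")
      case True
      have "rank A F (mult A \<beta> \<gamma>) <o k"
        using ordLeq_ordLess_trans[OF rank_mult_le(1)[OF \<beta>T \<gamma>] True] .
      moreover have "rank A F (mult A \<gamma> \<beta>) <o k"
        using ordLeq_ordLess_trans[OF ordLeq_transitive[OF r dim_image_B_le_rank[OF \<beta>T]] True] .
      ultimately show ?thesis using m unfolding T_below_def by blast
    next
      case False
      then obtain \<alpha> where \<alpha>: "\<alpha> \<in> S" "kernel A \<alpha> \<subseteq> kernel A \<beta>"
        using \<beta> unfolding T_below_def K_set_def by blast
      then have "dim F (\<beta> ` B) \<le>o dim F (\<alpha> ` B)" using S \<beta>T by (intro dim_kernel_le) auto
      \<comment> \<open>For \<open>\<beta>\<close> in K(S), multiplying on the left drops into the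
        part of rank below \<open>k\<close>, while multiplying on the right only enlarges the kernel
        and stays in K(S).\<close>
      then have "rank A F (mult A \<gamma> \<beta>) <o k"
        using r k[OF \<alpha>(1)] ordLeq_transitive ordLeq_ordLess_trans by blast
      moreover have "kernel A \<beta> \<subseteq> kernel A (mult A \<beta> \<gamma>)"
        unfolding kernel_def by (auto simp: mult_apply)
      ultimately show ?thesis using m \<alpha> unfolding T_below_def K_set_def by blast
    qed
  qed
  ultimately show ?thesis unfolding is_ideal_def by blast
qed

text \<open>The ideal serves as its own set \<open>S\<close>; kernel factorisation absorbs the
  K-part and rank factorisation the part of small rank.\<close>

lemma ideal_eq:
  assumes I: "is_ideal (mult A) T I"
  shows "I = T_below A F B (r_card F B I) \<union> K_set A F B I"
proof -
  have IT: "I \<subseteq> T" and right: "\<And>a s. a \<in> I \<Longrightarrow> s \<in> T \<Longrightarrow> mult A a s \<in> I"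
    and left: "\<And>a s. a \<in> I \<Longrightarrow> s \<in> T \<Longrightarrow> mult A s a \<in> I"
    using I unfolding is_ideal_def by auto
  have "I \<subseteq> K_set A F B I" using IT unfolding K_set_def by blast
  moreover have "\<beta> \<in> I" if "\<beta> \<in> K_set A F B I" for \<beta>
  proof -
    obtain \<alpha> where \<alpha>: "\<alpha> \<in> I" "\<beta> \<in> T" "kernel A \<alpha> \<subseteq> kernel A \<beta>"
      using \<open>\<beta> \<in> K_set A F B I\<close> unfolding K_set_def by blast
    then have "\<alpha> \<in> T" using IT by blast
    then obtain \<gamma> where "\<gamma> \<in> T" "\<beta> = mult A \<alpha> \<gamma>" using kernel_factor \<alpha> by metis
    then show ?thesis using right \<alpha> by blast
  qed
  moreover have "\<beta> \<in> I" if "\<beta> \<in> T_below A F B (r_card F B I)" for \<beta>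
  proof -
    let ?l = "rank A F \<beta>" and ?r = "r_card F B I"
    have \<beta>: "\<beta> \<in> T" "?l <o ?r" using that unfolding T_below_def by auto
    have c: "Card_order ?l" unfolding rank_def dim_def by (rule card_of_Card_order)
    \<comment> \<open>Otherwise the rank of \<open>\<beta>\<close> would itself be an admissible
      bound for \<open>I\<close>, smaller than the minimum \<open>?r\<close>.\<close>
    have "\<exists>\<alpha>\<in>I. \<not> dim F (\<alpha> ` B) <o ?l"
    proof (rule ccontr)
      assume "\<not> ?thesis"
      then have all: "\<And>\<alpha>. \<alpha> \<in> I \<Longrightarrow> dim F (\<alpha> ` B) <o ?l" by blast
      \<comment> \<open>The rank is a cardinal on \<open>'a\<close>, but \<open>r_bounds\<close>
        ranges over cardinals on \<open>'a set\<close>; singletons provide the isomorphic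
        copy.\<close>
      let ?\<mu> = "|(\<lambda>x. {x}) ` Field ?l|"
      have "|Field ?l| =o ?\<mu>"
        by (rule card_of_ordIsoI[of "\<lambda>x. {x}"]) (simp add: bij_betw_def inj_on_def)
      then have \<mu>: "?l =o ?\<mu>"
        using ordIso_transitive[OF ordIso_symmetric[OF card_of_Field_ordIso[OF c]]] by blast
      have "?r \<le>o cardSuc (dim F B)"
        using r_card_least(1)[OF IT] unfolding r_bounds_def by blast
      then have "?l \<le>o cardSuc (dim F B)"
        using \<beta>(2) ordLess_imp_ordLeq ordLeq_transitive by blast
      then have "?\<mu> \<le>o cardSuc (dim F B)"
        using \<mu> ordIso_ordLeq_trans ordIso_symmetric by blast
      moreover have "\<forall>\<alpha>\<in>I. dim F (\<alpha> ` B) <o ?\<mu>" using all \<mu> ordLess_ordIso_trans by blast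
      ultimately have "?\<mu> \<in> r_bounds F B I" unfolding r_bounds_def
        using card_of_Card_order by blast
      then have "?r \<le>o ?\<mu>" by (rule r_card_least(2)[OF IT])
      then have "?r \<le>o ?l" using \<mu> ordLeq_ordIso_trans ordIso_symmetric by blast
      then show False using \<beta>(2) not_ordLess_ordLeq by blast
    qed
    then obtain \<alpha> where \<alpha>: "\<alpha> \<in> I" "\<not> dim F (\<alpha> ` B) <o ?l" by blast
    have "?l \<le>o dim F (\<alpha> ` B)"
      using \<alpha>(2) not_ordLess_iff_ordLeq card_of_Well_order unfolding rank_def dim_def by metis
    moreover have "\<alpha> \<in> T" using \<alpha> IT by blast
    ultimately obtain \<gamma> \<delta> where "\<gamma> \<in> T" "\<delta> \<in> T" "\<beta> = mult A (mult A \<gamma> \<alpha>) \<delta>"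
      using rank_factor \<beta>(1) by metis
    then show ?thesis using left right \<alpha>(1) by blast
  qed
  ultimately show ?thesis by blast
qed

end

theorem theorem5p4:
  fixes A B :: "'a set" and F :: "'a operation set"
  assumes "independence_algebra A F"
    and "subalgebra A F B" and "B \<noteq> {}" and "B \<noteq> A"
    and "ctwo \<le>o dim F B \<or> gen F {} \<noteq> {} \<and> dim F B =o cone"
  shows "{I. is_ideal (mult A) (T_semigroup A F B) I} =
      {T_below A F B (r_card F B S) \<union> K_set A F B S | S. S \<noteq> {} \<and> S \<subseteq> T_semigroup A F B} \<union>
      {T_below A F B (cardSuc (r_card F B S)) \<union> K_set A F B S | S. S \<noteq> {} \<and> S \<subseteq> T_semigroup A F B}"
    (is "?I = ?U \<union> ?V")
proof -
  interpret restricted_range A F B using assms by unfold_locales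
  have r: "dim F (\<alpha> ` B) <o r_card F B S" "dim F (\<alpha> ` B) <o cardSuc (r_card F B S)"
    if "S \<subseteq> T_semigroup A F B" "\<alpha> \<in> S" for S \<alpha>
  proof -
    have *: "Card_order (r_card F B S)" "dim F (\<alpha> ` B) <o r_card F B S"
      using r_card_least(1)[OF that(1)] that(2) unfolding r_bounds_def by auto
    then show "dim F (\<alpha> ` B) <o r_card F B S" by blast
    show "dim F (\<alpha> ` B) <o cardSuc (r_card F B S)"
      using ordLess_transitive[OF *(2) cardSuc_greater[OF *(1)]] .
  qed
  have "?U \<subseteq> ?I" by (auto intro!: ideal_union r(1))
  moreover have "?V \<subseteq> ?I" by (auto intro!: ideal_union r(2))
  \<comment> \<open>Every ideal already occurs in the first family, with
    \<open>S = I\<close>.\<close>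
  moreover have "?I \<subseteq> ?U"
  proof
    fix I assume "I \<in> ?I"
    then have "is_ideal (mult A) (T_semigroup A F B) I" by simp
    then show "I \<in> ?U"
      using ideal_eq[of I] unfolding is_ideal_def by (intro CollectI exI[of _ I]) simp
  qed
  ultimately show ?thesis by (simp add: subset_antisym le_supI1)
qed

end
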